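(* For every prime power $q$, there is a unit ball packing in $d$-dimensional Euclidean space $\mathbb{R}^d$, where $d=q^3-q^2+q$, whose tangency graph is a strongly regular graph with chromatic number equal to $q^3+1$.
   Context: A ball packing in $d$-dimensional Euclidean space is a collection of balls with disjoint interiors. Its tangency graph has the balls as vertices and the tangent pairs of balls as edges. A unit ball packing is one in which all balls have the same radius; up to scaling it can be regarded as a set of points in $\mathbb{R}^d$ (the centers) such that the distance between any two distinct points is at least $1$, and the tangency graph is then the unit-distance graph of this set (two points are adjacent if and only if their distance is exactly $1$). The chromatic number of a ball packing is the chromatic number of its tangency graph. A strongly regular graph with parameters $(v,k,\lambda,\mu)$ is a $k$-regular graph on $v$ vertices such that every pair of adjacent vertices has exactly $\lambda$ common neighbors and every pair of distinct non-adjacent vertices has exactly $\mu$ common neighbors. *)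

theory Defs
  imports "HOL-Analysis.Analysis" "HOL-Number_Theory.Prime_Powers"
begin

text \<open>A ball is identified with the closed point set it occupies. In a Euclidean space of positive
  dimension this set determines its centre and its positive radius.\<close>

definition ball_packing :: "'a::euclidean_space set set \<Rightarrow> bool" where
  "ball_packing P \<longleftrightarrow>
     (\<forall>B\<in>P. \<exists>c r. 0 < r \<and> B = cball c r) \<and>
     pairwise (\<lambda>A B. interior A \<inter> interior B = {}) P"

definition unit_ball_packing :: "'a::euclidean_space set set \<Rightarrow> bool" where
  "unit_ball_packing P \<longleftrightarrow>
     ball_packing P \<and> (\<exists>r>0. \<forall>B\<in>P. \<exists>c. B = cball c r)"

text \<open>Balls of positive radius have nonempty interior, so no ball is tangent to itself.\<close>

definition tangent :: "'a::euclidean_space set \<Rightarrow> 'a set \<Rightarrow> bool" where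
  "tangent A B \<longleftrightarrow> A \<inter> B \<noteq> {} \<and> interior A \<inter> interior B = {}"

text \<open>Graphs are given by a vertex set \<open>V\<close> and an adjacency relation \<open>adj\<close>, of which only the
  restriction to \<open>V\<close> matters.\<close>

definition finite_simple_graph :: "'a set \<Rightarrow> ('a \<Rightarrow> 'a \<Rightarrow> bool) \<Rightarrow> bool" where
  "finite_simple_graph V adj \<longleftrightarrow>
     finite V \<and> (\<forall>x\<in>V. \<not> adj x x) \<and> (\<forall>x\<in>V. \<forall>y\<in>V. adj x y \<longrightarrow> adj y x)"

definition strongly_regular ::
  "'a set \<Rightarrow> ('a \<Rightarrow> 'a \<Rightarrow> bool) \<Rightarrow> nat \<Rightarrow> nat \<Rightarrow> nat \<Rightarrow> nat \<Rightarrow> bool" where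
  "strongly_regular V adj v k l m \<longleftrightarrow>
     finite_simple_graph V adj \<and> card V = v \<and>
     (\<forall>x\<in>V. card {y\<in>V. adj x y} = k) \<and>
     (\<forall>x\<in>V. \<forall>y\<in>V. adj x y \<longrightarrow> card {z\<in>V. adj x z \<and> adj y z} = l) \<and>
     (\<forall>x\<in>V. \<forall>y\<in>V. x \<noteq> y \<and> \<not> adj x y \<longrightarrow> card {z\<in>V. adj x z \<and> adj y z} = m)"

definition colorable :: "'a set \<Rightarrow> ('a \<Rightarrow> 'a \<Rightarrow> bool) \<Rightarrow> nat \<Rightarrow> bool" where
  "colorable V adj n \<longleftrightarrow>
     (\<exists>c::'a \<Rightarrow> nat. (\<forall>x\<in>V. c x < n) \<and> (\<forall>x\<in>V. \<forall>y\<in>V. adj x y \<longrightarrow> c x \<noteq> c y))"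

text \<open>The least element exists for every finite simple graph; for graphs without a finite proper
  colouring the value is unspecified.\<close>

definition chromatic_number :: "'a set \<Rightarrow> ('a \<Rightarrow> 'a \<Rightarrow> bool) \<Rightarrow> nat" where
  "chromatic_number V adj = (LEAST n. colorable V adj n)"

end

(* The points of the elliptic quadric Q^-(5,q), with q = p^n, are modelled as the F_q-points of the
   isotropic vectors of a nondegenerate Hermitian form on F^3, where F is the field with q^2
   elements; two points are collinear iff their Hermitian product has trace 0 over F_q. They form a
   generalized quadrangle of order (q, q^2), whose collinearity graph is strongly regular with
   least eigenvalue -(q^2 + 1) of multiplicity q^3 - q^2 + q. In the projection onto the
   corresponding eigenspace, two distinct points have inner product proportional to -1/q if they
   are collinear and to 1/q^2 otherwise, so the tangency graph is the noncollinearity graph.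
   Its independent sets are cliques of the collinearity graph, hence have at most q + 1 elements,
   and the q^3 + 1 points of the Hermitian curve of F^3 split the quadric into lines with q + 1
   points each (a spread): this gives both bounds on the chromatic number. *)
theory Submission
  imports
    "HOL-Algebra.Algebraic_Closure_Type"
    "Berlekamp_Zassenhaus.Finite_Field"
    Defs
begin

section \<open>Finite fields inside an algebraically closed field\<close>

text \<open>The polynomial splits into linear factors, and a repeated factor would give a common
  root of \<open>p\<close> and its derivative; so no root is repeated among the
  \<open>degree p\<close> factors.\<close>

lemma card_roots_simple:
  fixes p :: "'a::alg_closed_field poly"
  assumes simple: "\<And>x. poly p x = 0 \<Longrightarrow> poly (pderiv p) x \<noteq> 0" and "p \<noteq> 0"
  shows "finite {x. poly p x = 0}" and "card {x. poly p x = 0} = degree p"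
proof -
  show "finite {x. poly p x = 0}" using \<open>p \<noteq> 0\<close> by (rule poly_roots_finite)
  obtain A c where A: "size A = degree p" "p = smult c (\<Prod>x\<in>#A. [:-x, 1:])"
    using alg_closed_imp_factorization[OF \<open>p \<noteq> 0\<close>] by blast
  have "c \<noteq> 0" using A(2) \<open>p \<noteq> 0\<close> by auto
  then have set: "{x. poly p x = 0} = set_mset A"
    unfolding A(2) by (auto simp: poly_prod_mset prod_mset_zero_iff)
  have "count A x = 1" if "x \<in># A" for x
  proof (rule ccontr)
    assume "count A x \<noteq> 1"
    moreover have "count A x > 0" using that unfolding count_greater_zero_iff .
    ultimately have "count A x > 1" by linarith
    then have "x \<in># A - {#x#}" unfolding in_diff_count by simp
    then obtain B where B0: "A - {#x#} = add_mset x B" by (blast dest: multi_member_split)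
    have B: "A = add_mset x (add_mset x B)"
      unfolding B0[symmetric] by (rule insert_DiffM[OF that, symmetric])
    define r where "r = smult c (\<Prod>x\<in>#B. [:-x, 1:])"
    have "p = [:-x, 1:] * ([:-x, 1:] * r)"
      unfolding A(2) B r_def by (simp only: image_mset_add_mset prod_mset.add_mset mult_smult_right)
    then have "poly p x = 0 \<and> poly (pderiv p) x = 0"
      by (simp add: pderiv_mult del: mult_pCons_left mult_pCons_right)
    with simple show False by blast
  qed
  then have "(\<Sum>x\<in>set_mset A. count A x) = (\<Sum>x\<in>set_mset A. 1)"
    by (intro sum.cong refl)
  then have "size A = card (set_mset A)"
    unfolding size_multiset_overloaded_eq by simp
  with A(1) set show "card {x. poly p x = 0} = degree p" by simp
qed

text \<open>\<open>X ^ n - c\<close> is separable: its derivative vanishes at most at 0, which is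
  not a root since \<open>c\<close> is nonzero.\<close>

lemma card_power_roots:
  fixes c :: "'a::alg_closed_field"
  assumes n: "of_nat n \<noteq> (0::'a)" and c: "c \<noteq> 0"
  shows "finite {x. x ^ n = c}" and "card {x. x ^ n = c} = n"
proof -
  have n0: "n > 0" using n by (cases n) auto
  define p where "p = monom 1 n - [:c:]"
  have poly: "poly p x = x ^ n - c" for x by (simp add: p_def poly_monom)
  have deg: "degree p = n"
    unfolding p_def using n0 by (subst diff_conv_add_uminus, subst degree_add_eq_left) (auto simp: degree_monom_eq)
  then have nz: "p \<noteq> 0" using n0 by auto
  have simple: "poly (pderiv p) x \<noteq> 0" if "poly p x = 0" for x
  proof -
    have "x \<noteq> 0" using that c n0 by (auto simp: poly power_0_left)
    then show ?thesis using n by (simp add: p_def pderiv_diff pderiv_monom poly_monom pderiv_pCons)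
  qed
  show "finite {x. x ^ n = c}" "card {x. x ^ n = c} = n"
    using card_roots_simple[OF simple nz] deg by (simp_all add: poly)
qed

section \<open>The Frobenius map and the field with q^2 elements\<close>

text \<open>Working inside one algebraically closed field turns counts of field elements into counts
  of roots; \<open>x ^ q\<close> serves as the conjugation of the field with q^2 elements over its
  subfield of order q.\<close>

locale frobenius =
  fixes q n :: nat and ty :: "'a::alg_closed_field itself"
  assumes char_prime: "prime CHAR('a)" and q_eq: "q = CHAR('a) ^ n" and n_pos: "n > 0"
begin

lemma q_ge_2: "q \<ge> 2"
proof -
  have "CHAR('a) ^ 1 \<le> q"
    unfolding q_eq using n_pos prime_gt_0_nat[OF char_prime] by (intro power_increasing) auto
  then show ?thesis using prime_ge_2_nat[OF char_prime] by simp
qed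

lemma of_nat_q [simp]: "of_nat q = (0::'a)"
  using n_pos by (simp add: q_eq)

lemma frob_add: "(x + y :: 'a) ^ q = x ^ q + y ^ q"
  by (rule freshmans_dream'[OF char_prime q_eq])

lemma frob_minus: "(- x :: 'a) ^ q = - (x ^ q)"
proof -
  have "(- x) ^ q + x ^ q = (- x + x) ^ q" by (simp only: frob_add)
  also have "\<dots> = 0" using q_ge_2 by (simp add: power_0_left)
  finally show ?thesis by (simp add: eq_neg_iff_add_eq_0)
qed

lemma frob_diff: "(x - y :: 'a) ^ q = x ^ q - y ^ q"
  using frob_add[of x "- y"] by (simp add: frob_minus)

lemma neg_power_Suc_q: "(- x :: 'a) ^ (q + 1) = x ^ (q + 1)"
  by (simp add: frob_minus)

lemma of_nat_q_minus_1: "of_nat (q - 1) \<noteq> (0::'a)"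
  using q_ge_2 by (simp add: of_nat_diff)

text \<open>The fixed points of the squared Frobenius map: the field F with q^2 elements.\<close>

definition field2 :: "'a set" where "field2 = {x. x ^ (q\<^sup>2) = x}"

lemma frob_frob: "x \<in> field2 \<Longrightarrow> (x ^ q) ^ q = x"
  by (simp add: field2_def power2_eq_square flip: power_mult)

lemma field2_iff: "x \<in> field2 \<longleftrightarrow> (x ^ q) ^ q = x"
  by (simp add: field2_def power2_eq_square flip: power_mult)

lemma field2_add: "x \<in> field2 \<Longrightarrow> y \<in> field2 \<Longrightarrow> x + y \<in> field2"
  by (simp add: field2_iff frob_add)

lemma field2_minus: "x \<in> field2 \<Longrightarrow> - x \<in> field2"
  by (simp add: field2_iff frob_minus)

lemma field2_diff: "x \<in> field2 \<Longrightarrow> y \<in> field2 \<Longrightarrow> x - y \<in> field2"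
  by (simp add: field2_iff frob_diff)

lemma field2_mult: "x \<in> field2 \<Longrightarrow> y \<in> field2 \<Longrightarrow> x * y \<in> field2"
  by (simp add: field2_iff power_mult_distrib)

lemma field2_divide: "x \<in> field2 \<Longrightarrow> y \<in> field2 \<Longrightarrow> x / y \<in> field2"
  by (simp add: field2_iff power_divide)

lemma field2_power: "x \<in> field2 \<Longrightarrow> x ^ m \<in> field2"
  unfolding field2_def mem_Collect_eq by (metis mult.commute power_mult)

lemma field2_0 [simp]: "0 \<in> field2" and field2_1 [simp]: "1 \<in> field2"
  using q_ge_2 by (simp_all add: field2_def power_0_left)

lemmas field2_closed = field2_add field2_minus field2_diff field2_mult field2_divide field2_power

lemma q2_factor: "q\<^sup>2 = Suc ((q - 1) * (q + 1))"
  using q_ge_2 by (cases q) (auto simp: power2_eq_square algebra_simps)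

lemma field2_nonzero_iff: "x \<noteq> 0 \<Longrightarrow> x \<in> field2 \<longleftrightarrow> x ^ ((q - 1) * (q + 1)) = 1"
  unfolding field2_def q2_factor by simp

lemma card_field2: "finite field2" "card field2 = q\<^sup>2"
proof -
  let ?m = "(q - 1) * (q + 1)"
  \<comment> \<open>The exponent is q^2 - 1, which equals -1 in the field.\<close>
  have "of_nat ?m \<noteq> (0::'a)"
    using of_nat_q_minus_1 by simp
  note R = card_power_roots[OF this, of 1]
  have m: "?m > 0" using q_ge_2 by simp
  have eq: "field2 = insert 0 {x. x ^ ?m = 1}"
  proof (rule Set.set_eqI)
    fix x :: 'a
    show "x \<in> field2 \<longleftrightarrow> x \<in> insert 0 {x. x ^ ?m = 1}"
      using field2_nonzero_iff[of x] by (cases "x = 0") auto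
  qed
  show "finite field2" unfolding eq using R by simp
  have "0 \<notin> {x::'a. x ^ ?m = 1}" using m by (auto simp: power_0_left)
  then show "card field2 = q\<^sup>2" unfolding eq q2_factor using R by (simp del: of_nat_mult)
qed

lemma card_norm_fibre:
  "c \<noteq> 0 \<Longrightarrow> finite {x::'a. x ^ (q + 1) = c}" "c \<noteq> 0 \<Longrightarrow> card {x::'a. x ^ (q + 1) = c} = q + 1"
  using card_power_roots[of "q + 1" c] by simp_all

lemma card_q_minus_1_fibre:
  "c \<noteq> 0 \<Longrightarrow> finite {x::'a. x ^ (q - 1) = c}" "c \<noteq> 0 \<Longrightarrow> card {x::'a. x ^ (q - 1) = c} = q - 1"
  using card_power_roots[OF of_nat_q_minus_1] by simp_all

text \<open>\<open>X ^ q + X - s\<close> has derivative 1, because \<open>q\<close> is 0 in the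
  field, so all its roots are simple.\<close>

lemma card_trace_fibre:
  "finite {z::'a. z + z ^ q = s}" "card {z::'a. z + z ^ q = s} = q"
proof -
  define p :: "'a poly" where "p = monom 1 q + [:-s, 1:]"
  have poly: "poly p x = 0 \<longleftrightarrow> x + x ^ q = s" for x
    by (auto simp: p_def poly_monom algebra_simps)
  have deg: "degree p = q"
    unfolding p_def using q_ge_2 by (subst degree_add_eq_left) (auto simp: degree_monom_eq)
  then have nz: "p \<noteq> 0" using q_ge_2 by auto
  have simple: "poly (pderiv p) x \<noteq> 0" for x
    by (simp add: p_def pderiv_add pderiv_monom pderiv_pCons)
  show "finite {z::'a. z + z ^ q = s}" "card {z::'a. z + z ^ q = s} = q"
    using card_roots_simple[OF simple nz] deg by (simp_all add: poly)
qed

text \<open>Raising \<open>z ^ q = s - z\<close> to the power \<open>q\<close> gives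
  \<open>(z ^ q) ^ q = s - z ^ q = z\<close>.\<close>

lemma trace_fibre_field2:
  assumes "z + z ^ q = s" "s ^ q = s"
  shows "z \<in> field2"
proof -
  have z: "z ^ q = s - z" using assms(1) by (simp add: algebra_simps)
  have "(z ^ q) ^ q = s ^ q - z ^ q" by (subst z) (rule frob_diff)
  also have "\<dots> = z" unfolding assms(2) z by simp
  finally show ?thesis by (simp only: field2_iff)
qed

section \<open>The Hermitian curve and its form\<close>

lemma norm_frob:
  assumes "y \<in> field2" shows "(y ^ (q + 1)) ^ q = y ^ (q + 1)"
proof -
  have "(y ^ (q + 1)) ^ q = (y * y ^ q) ^ q" by simp
  also have "\<dots> = y ^ q * (y ^ q) ^ q" by (rule power_mult_distrib)
  finally show ?thesis using frob_frob[OF assms] by simp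
qed

text \<open>\<open>None\<close> stands for the vector \<open>(0, 0, 1)\<close> and \<open>Some (y, z)\<close> for \<open>(1, y, z)\<close>; the form is
  \<open>x\<^sub>1 x\<^sub>3'\<^sup>q + x\<^sub>3 x\<^sub>1'\<^sup>q + x\<^sub>2 x\<^sub>2'\<^sup>q\<close>.\<close>

fun herm :: "('a \<times> 'a) option \<Rightarrow> ('a \<times> 'a) option \<Rightarrow> 'a" where
  "herm None None = 0"
| "herm None (Some (y, z)) = 1"
| "herm (Some (y, z)) None = 1"
| "herm (Some (y, z)) (Some (y', z')) = z + z' ^ q + y * y' ^ q"

text \<open>The isotropic points: the equation says that the form vanishes at
  \<open>(1, y, z)\<close>. That \<open>z\<close> lies in \<open>field2\<close> is a consequence
  (\<open>Some_in_curveD\<close>), as the norm of \<open>y\<close> is fixed by the Frobenius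
  map.\<close>

definition curve :: "('a \<times> 'a) option set" where
  "curve = insert None (Some ` (SIGMA y:field2. {z. z + z ^ q = - (y ^ (q + 1))}))"

lemma None_in_curve [simp]: "None \<in> curve"
  by (simp add: curve_def)

lemma Some_in_curve_iff: "Some (y, z) \<in> curve \<longleftrightarrow> y \<in> field2 \<and> z + z ^ q = - (y ^ (q + 1))"
  by (auto simp: curve_def)

lemma card_curve: "finite curve" "card curve = q ^ 3 + 1"
proof -
  let ?A = "SIGMA y:field2. {z::'a. z + z ^ q = - (y ^ (q + 1))}"
  have fin: "finite ?A" using card_field2 card_trace_fibre by (intro finite_SigmaI) auto
  have "card ?A = (\<Sum>y\<in>field2. q)"
    using card_field2 card_trace_fibre by (subst card_SigmaI) auto
  also have "\<dots> = q ^ 3" using card_field2 by (simp add: power2_eq_square power3_eq_cube)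
  finally have "card ?A = q ^ 3" .
  then show "finite curve" "card curve = q ^ 3 + 1"
    unfolding curve_def using fin by (auto simp: card_image)
qed

lemma Some_in_curveD:
  assumes "Some (y, z) \<in> curve"
  shows "y \<in> field2" "z \<in> field2" "z ^ q = - z - y * y ^ q"
proof -
  show y: "y \<in> field2" using assms by (simp add: Some_in_curve_iff)
  have eq: "z + z ^ q = - (y ^ (q + 1))" using assms by (simp add: Some_in_curve_iff)
  have "(- (y ^ (q + 1))) ^ q = - (y ^ (q + 1))"
    by (simp only: frob_minus norm_frob[OF y])
  with eq show "z \<in> field2" by (rule trace_fibre_field2)
  have "z ^ q = (z + z ^ q) - z" by simp
  also have "\<dots> = - z - y * y ^ q" unfolding eq by simp
  finally show "z ^ q = - z - y * y ^ q" .
qed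

lemma herm_field2: "P \<in> curve \<Longrightarrow> P' \<in> curve \<Longrightarrow> herm P P' \<in> field2"
  by (induction P P' rule: herm.induct) (auto intro!: field2_closed intro: Some_in_curveD(1) Some_in_curveD(2))

lemma herm_frob: "P \<in> curve \<Longrightarrow> P' \<in> curve \<Longrightarrow> herm P P' ^ q = herm P' P"
proof (induction P P' rule: herm.induct)
  case (4 y z y' z')
  show ?case
    using frob_frob[OF Some_in_curveD(1)[OF 4(2)]] frob_frob[OF Some_in_curveD(2)[OF 4(2)]]
    by (simp add: frob_add power_mult_distrib mult.commute)
qed (use q_ge_2 in \<open>auto simp: power_0_left\<close>)

text \<open>The difference of the two isotropic vectors has first coordinate 0, so the form takes
  the norm of \<open>y - y'\<close> there; expanding it leaves minus the two mixed products.\<close>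

lemma herm_trace:
  assumes "Some (y, z) \<in> curve" "Some (y', z') \<in> curve"
  shows "herm (Some (y, z)) (Some (y', z')) + herm (Some (y', z')) (Some (y, z)) + (y - y') * (y - y') ^ q = 0"
  by (simp add: Some_in_curveD(3)[OF assms(1)] Some_in_curveD(3)[OF assms(2)] frob_diff algebra_simps)

text \<open>If the product vanishes, so does its conjugate; \<open>herm_trace\<close> then kills the
  norm of \<open>y - y'\<close>, and isotropy gives \<open>z = z'\<close>. The form has Witt index
  1.\<close>

lemma herm_eq_0_iff:
  assumes "P \<in> curve" "P' \<in> curve"
  shows "herm P P' = 0 \<longleftrightarrow> P = P'"
proof (cases "(P, P')" rule: herm.cases)
  case (4 y z y' z')
  then have P: "P = Some (y, z)" "P' = Some (y', z')" by auto
  note c = assms[unfolded P]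
  show ?thesis
  proof
    assume 0: "herm P P' = 0"
    then have "herm P' P = 0" using herm_frob[OF assms] q_ge_2 by (simp add: power_0_left)
    with 0 herm_trace[OF c] have "(y - y') * (y - y') ^ q = 0" by (simp add: P)
    then have y: "y = y'" by auto
    with 0 Some_in_curveD(3)[OF c(2)] show "P = P'" by (simp add: P)
  next
    assume "P = P'"
    then show "herm P P' = 0" using Some_in_curveD(3)[OF c(2)] by (simp add: P)
  qed
qed (use assms in auto)

section \<open>Counting points of the curve by a ratio of Hermitian products\<close>

text \<open>With \<open>c = u' / u\<close> there are q - 1 values of \<open>t\<close> with
  \<open>t ^ (q - 1) = c\<close>. Each prescribes the norm \<open>- (1 + c) * t\<close> for
  \<open>y\<close>, which leaves only \<open>y = 0\<close> if \<open>c = -1\<close> and q + 1 values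
  otherwise.\<close>

lemma card_affine_fibre:
  assumes u: "u \<noteq> 0" "u' \<noteq> 0" and norm: "u ^ (q + 1) = u' ^ (q + 1)"
  defines "S \<equiv> {(t::'a, y). t \<noteq> 0 \<and> y \<in> field2 \<and> t + t ^ q + y * y ^ q = 0 \<and> u * t ^ q = u' * t}"
  shows "finite S" "card S = (if u = - u' then q - 1 else q\<^sup>2 - 1)"
proof -
  define c where "c = u' / u"
  have c0: "c \<noteq> 0" using u by (simp add: c_def)
  have cnorm: "c ^ (q + 1) = 1" unfolding c_def power_divide norm using u by (simp del: power_Suc)
  define T where "T = {t::'a. t ^ (q - 1) = c}"
  have T: "finite T" "card T = q - 1"
    unfolding T_def by (fact card_q_minus_1_fibre[OF c0])+
  have T_nz: "t \<noteq> 0" if "t \<in> T" for t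
    using that c0 q_ge_2 by (auto simp: T_def power_0_left)
  have q': "q = Suc (q - 1)" using q_ge_2 by simp
  have T_iff: "t \<in> T \<longleftrightarrow> t \<noteq> 0 \<and> t ^ q = c * t" for t
    unfolding T_def using c0 T_nz[unfolded T_def, of t] by (subst (2) q') auto
  have uc: "u * t ^ q = u' * t \<longleftrightarrow> t ^ q = c * t" for t
    using u by (simp add: c_def field_simps)
  define Y where "Y t = {y \<in> field2. y ^ (q + 1) = - (1 + c) * t}" for t
  have lin: "t + c * t + w = 0 \<longleftrightarrow> w = - (1 + c) * t" for t w
    by (auto simp: algebra_simps eq_neg_iff_add_eq_0)
  have yq: "y ^ (q + 1) = y * y ^ q" for y :: 'a by simp
  have "(t, y) \<in> S \<longleftrightarrow> (t, y) \<in> Sigma T Y" for t y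
    unfolding S_def Y_def mem_Sigma_iff mem_Collect_eq case_prod_conv T_iff uc yq
    by (cases "t ^ q = c * t") (auto simp only: lin)
  then have S: "S = Sigma T Y" by (intro Set.set_eqI) (metis surj_pair)
  have cu: "1 + c = 0 \<longleftrightarrow> u = - u'"
    using u by (simp add: c_def field_simps eq_neg_iff_add_eq_0)
  have "finite (Y t) \<and> card (Y t) = (if u = - u' then 1 else q + 1)" if t: "t \<in> T" for t
  proof (cases "u = - u'")
    case True
    then have "Y t = {0}" using cu by (auto simp: Y_def)
    with True show ?thesis by simp
  next
    case False
    define s where "s = - (1 + c) * t"
    have "1 + c \<noteq> 0" using False cu by blast
    with T_nz[OF t] have s0: "s \<noteq> 0"
      unfolding s_def by (simp only: mult_eq_0_iff neg_equal_0_iff_equal simp_thms)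
    have tq: "t ^ q = c * t" using t unfolding T_iff by blast
    have "(t ^ q) ^ q = c ^ q * t ^ q" by (subst tq) (rule power_mult_distrib)
    also have "\<dots> = c ^ (q + 1) * t" by (simp only: tq power_add power_one_right mult.assoc)
    also have "\<dots> = t" by (simp only: cnorm) simp
    finally have tqq: "(t ^ q) ^ q = t" .
    \<comment> \<open>As minus the trace of \<open>t\<close>, \<open>s\<close> is fixed by the
      Frobenius map; hence all q + 1 roots of \<open>y ^ (q + 1) = s\<close> lie in
      \<open>field2\<close>.\<close>
    have s: "s = - (t + t ^ q)" by (simp add: s_def tq algebra_simps)
    have "s ^ q = s" unfolding s by (simp only: frob_minus frob_add tqq add.commute)
    then have "s ^ (q - 1) = 1" using s0 by (subst (asm) q') simp
    then have "y \<in> field2" if y: "y ^ (q + 1) = s" for y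
    proof -
      have "y ^ ((q - 1) * (q + 1)) = (y ^ (q + 1)) ^ (q - 1)" by (metis mult.commute power_mult)
      with \<open>s ^ (q - 1) = 1\<close> y have "y ^ ((q - 1) * (q + 1)) = 1" by simp
      moreover have "y \<noteq> 0" using y s0 by auto
      ultimately show ?thesis using field2_nonzero_iff by blast
    qed
    then have "Y t = {y. y ^ (q + 1) = s}" by (auto simp: Y_def s_def)
    with False card_norm_fibre[OF s0] show ?thesis by simp
  qed
  with T show "finite S" "card S = (if u = - u' then q - 1 else q\<^sup>2 - 1)"
    unfolding S by (auto simp: card_SigmaI q2_factor simp del: power_Suc)
qed

text \<open>For unitary \<open>u\<close> and \<open>u'\<close> the condition is
  \<open>partner P u R = partner P' u' R\<close> with denominators cleared: \<open>(P, u)\<close>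
  and \<open>(P', u')\<close> have a common collinear point over \<open>R\<close>.\<close>

definition tri :: "('a \<times> 'a) option \<Rightarrow> ('a \<times> 'a) option \<Rightarrow> 'a \<Rightarrow> 'a \<Rightarrow> ('a \<times> 'a) option set" where
  "tri P P' u u' = {R \<in> curve - {P, P'}. u * (herm R P * herm P' R) = u' * (herm P R * herm R P')}"

lemma finite_tri: "finite (tri P P' u u')"
  using card_curve by (simp add: tri_def)

text \<open>Products with the point at infinity are 1. In the coordinates
  \<open>t = herm R P'\<close> and \<open>y - y0\<close>, where \<open>P' = Some (y0, z0)\<close>,
  the curve equation becomes \<open>herm_trace\<close> and the condition reads
  \<open>u * t ^ q = u' * t\<close>, as in \<open>card_affine_fibre\<close>.\<close>

lemma card_tri_None:
  assumes P: "Some (y0, z0) \<in> curve"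
    and u: "u \<noteq> 0" "u' \<noteq> 0" "u ^ (q + 1) = u' ^ (q + 1)"
  shows "card (tri None (Some (y0, z0)) u u') = (if u = - u' then q - 1 else q\<^sup>2 - 1)"
proof -
  define S where "S = {(t::'a, y). t \<noteq> 0 \<and> y \<in> field2 \<and> t + t ^ q + y * y ^ q = 0 \<and> u * t ^ q = u' * t}"
  define f where "f R = (herm R (Some (y0, z0)), fst (the R) - y0)" for R :: "('a \<times> 'a) option"
  define g where "g = (\<lambda>(t, y). Some (y + y0, t - z0 ^ q - (y + y0) * y0 ^ q))"
  note P' = Some_in_curveD[OF P]
  have "bij_betw f (tri None (Some (y0, z0)) u u') S"
  proof (rule bij_betw_byWitness[where f' = g])
    show "\<forall>R\<in>tri None (Some (y0, z0)) u u'. g (f R) = R"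
      by (auto simp: tri_def f_def g_def)
    show "\<forall>s\<in>S. f (g s) = s" by (auto simp: f_def g_def)
    show "f ` tri None (Some (y0, z0)) u u' \<subseteq> S"
    proof (rule image_subsetI)
      fix R assume R: "R \<in> tri None (Some (y0, z0)) u u'"
      then obtain y z where yz: "R = Some (y, z)" and Rc: "Some (y, z) \<in> curve" and ne: "R \<noteq> Some (y0, z0)"
        by (auto simp: tri_def)
      define t where "t = herm R (Some (y0, z0))"
      have tq: "t ^ q = herm (Some (y0, z0)) R"
        unfolding t_def yz by (rule herm_frob[OF Rc P])
      have "t \<noteq> 0" using ne herm_eq_0_iff[OF Rc P] by (simp add: t_def yz)
      moreover have "t + t ^ q + (y - y0) * (y - y0) ^ q = 0"
        unfolding tq unfolding t_def yz by (rule herm_trace[OF Rc P])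
      moreover have "u * t ^ q = u' * t" unfolding tq unfolding t_def using R by (simp add: tri_def yz)
      ultimately show "f R \<in> S"
        using field2_diff[OF Some_in_curveD(1)[OF Rc] P'(1)] by (simp add: S_def f_def t_def yz)
    qed
    show "g ` S \<subseteq> tri None (Some (y0, z0)) u u'"
    proof (rule image_subsetI)
      fix ty assume "ty \<in> S"
      then obtain t y where ty: "ty = (t, y)" and t0: "t \<noteq> 0" and y: "y \<in> field2" and t: "t + t ^ q + y * y ^ q = 0" and ut: "u * t ^ q = u' * t"
        unfolding S_def by blast
      define z where "z = t - z0 ^ q - (y + y0) * y0 ^ q"
      have tq: "t ^ q = - t - y * y ^ q" using t by (simp add: algebra_simps eq_neg_iff_add_eq_0)
      have zq: "z ^ q = t ^ q - z0 - (y ^ q + y0 ^ q) * y0"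
        unfolding z_def by (simp only: frob_diff frob_add power_mult_distrib frob_frob[OF P'(1)] frob_frob[OF P'(2)])
      have c: "Some (y + y0, z) \<in> curve"
        unfolding Some_in_curve_iff zq unfolding z_def
        using field2_add[OF y P'(1)] tq P'(3) by (simp add: frob_add algebra_simps)
      have h: "herm (Some (y + y0, z)) (Some (y0, z0)) = t" by (simp add: z_def)
      have h': "herm (Some (y0, z0)) (Some (y + y0, z)) = t ^ q"
        using herm_frob[OF c P] by (simp only: h)
      have "Some (y + y0, z) \<noteq> Some (y0, z0)" using t0 h herm_eq_0_iff[OF c P] by metis
      then show "g ty \<in> tri None (Some (y0, z0)) u u'"
        using c h h' ut by (simp add: ty tri_def g_def z_def[symmetric] del: herm.simps(4))
    qed
  qed
  then have "card (tri None (Some (y0, z0)) u u') = card S" by (rule bij_betw_same_card)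
  with card_affine_fibre[OF u] show ?thesis by (simp add: S_def)
qed

text \<open>The isometry that translates \<open>P\<close> to \<open>(1, 0, 0)\<close> and then swaps the first and third
  coordinates sends \<open>P\<close> to infinity; only its values at points other than \<open>P\<close> are meaningful.\<close>

fun to_infinity :: "('a \<times> 'a) option \<Rightarrow> ('a \<times> 'a) option \<Rightarrow> ('a \<times> 'a) option" where
  "to_infinity None R = R"
| "to_infinity (Some (y1, z1)) None = Some (0, 0)"
| "to_infinity (Some (y1, z1)) (Some (y, z)) =
     Some ((y - y1) / herm (Some (y, z)) (Some (y1, z1)), 1 / herm (Some (y, z)) (Some (y1, z1)))"

text \<open>Normalizing the image of \<open>R\<close> under the isometry divides it by its first
  coordinate \<open>herm R P\<close>. Sesquilinearity thus divides the form by
  \<open>herm R P\<close> and by the conjugate of \<open>herm R' P\<close>, which is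
  \<open>herm P R'\<close>.\<close>

lemma to_infinity_herm:
  assumes P: "Some (y1, z1) \<in> curve" and R: "R \<in> curve" "R' \<in> curve" "R \<noteq> Some (y1, z1)" "R' \<noteq> Some (y1, z1)"
  defines "f \<equiv> to_infinity (Some (y1, z1))"
  shows "herm (f R) (f R') * herm R (Some (y1, z1)) * herm (Some (y1, z1)) R' = herm R R'"
proof -
  let ?P = "Some (y1, z1)"
  have nz: "herm R ?P \<noteq> 0" "herm ?P R' \<noteq> 0"
    using herm_eq_0_iff[OF R(1) P] herm_eq_0_iff[OF P R(2)] R(3,4) by auto
  have frob': "herm R' ?P ^ q = herm ?P R'" by (rule herm_frob[OF R(2) P])
  have 0: "(0::'a) ^ q = 0" using q_ge_2 by (simp add: power_0_left)
  show ?thesis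
  proof (cases "(R, R')" rule: herm.cases)
    case 1
    then show ?thesis by (simp add: f_def 0)
  next
    case (2 y' z')
    then have "herm (f R) (f R') = (1 / herm R' ?P) ^ q" "herm R ?P = 1" "herm R R' = 1"
      by (simp_all add: f_def)
    with nz frob' show ?thesis by (simp add: power_divide)
  next
    case (3 y z)
    then have "herm (f R) (f R') = 1 / herm R ?P" "herm ?P R' = 1" "herm R R' = 1"
      by (simp_all add: f_def 0)
    with nz show ?thesis by simp
  next
    case (4 y z y' z')
    then have RR: "R = Some (y, z)" "R' = Some (y', z')" by auto
    define T where "T = herm R ?P"
    define T' where "T' = herm R' ?P"
    define T1 where "T1 = herm ?P R'"
    have T1: "T' ^ q = T1" "T \<noteq> 0" "T1 \<noteq> 0" using frob' nz by (simp_all add: T_def T'_def T1_def)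
    have "f R = Some ((y - y1) / T, 1 / T)" "f R' = Some ((y' - y1) / T', 1 / T')"
      by (simp_all add: f_def T_def T'_def RR)
    then have h: "herm (f R) (f R') = 1 / T + 1 / T1 + (y - y1) * (y' - y1) ^ q / (T * T1)"
      by (simp add: power_divide T1)
    have "(1 / T + 1 / T1 + w / (T * T1)) * T * T1 = T1 + T + w" for w
      using T1(2,3) by (simp add: distrib_left distrib_right)
    then have "herm (f R) (f R') * T * T1 = T1 + T + (y - y1) * (y' - y1) ^ q"
      unfolding h .
    also have "\<dots> = herm R R'"
      using 4 by (simp add: T_def T1_def frob_diff Some_in_curveD(3)[OF P] algebra_simps)
    finally show ?thesis by (simp add: T_def T1_def)
  qed
qed

text \<open>For finite \<open>R\<close>, dividing \<open>herm_trace\<close> by the norm of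
  \<open>herm R P\<close> gives the isotropy equation of the image.\<close>

lemma to_infinity_curve:
  assumes P: "Some (y1, z1) \<in> curve" and R: "R \<in> curve" "R \<noteq> Some (y1, z1)"
  shows "to_infinity (Some (y1, z1)) R \<in> curve - {None}"
proof (cases R)
  case None
  then show ?thesis using q_ge_2 by (auto simp: Some_in_curve_iff power_0_left)
next
  case (Some r)
  then obtain y z where yz: "R = Some (y, z)" by (cases r) auto
  note c = R(1)[unfolded yz]
  let ?P = "Some (y1, z1)"
  define T where "T = herm (Some (y, z)) ?P"
  have T0: "T \<noteq> 0" using R herm_eq_0_iff[OF c P] by (simp add: T_def yz)
  have TF: "T \<in> field2" unfolding T_def using c P by (rule herm_field2)
  have tr: "T + T ^ q + (y - y1) * (y - y1) ^ q = 0"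
    using herm_trace[OF c P] herm_frob[OF c P] by (simp only: T_def)
  have "1 / T + (1 / T) ^ q + ((y - y1) / T) ^ (q + 1)
      = (T + T ^ q + (y - y1) * (y - y1) ^ q) / (T * T ^ q)"
    using T0 by (simp add: power_divide field_simps)
  also have "\<dots> = 0" unfolding tr by simp
  finally have "1 / T + (1 / T) ^ q = - (((y - y1) / T) ^ (q + 1))"
    by (simp only: eq_neg_iff_add_eq_0)
  moreover have "(y - y1) / T \<in> field2"
    using Some_in_curveD(1)[OF c] Some_in_curveD(1)[OF P] TF by (intro field2_closed)
  ultimately show ?thesis
    by (simp add: yz T_def[symmetric] Some_in_curve_iff del: herm.simps(4))
qed

text \<open>The form detects equality of points by \<open>herm_eq_0_iff\<close>, and
  \<open>to_infinity_herm\<close> carries its vanishing back from the images.\<close>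

lemma inj_to_infinity:
  assumes P: "Some (y1, z1) \<in> curve"
  shows "inj_on (to_infinity (Some (y1, z1))) (curve - {Some (y1, z1)})"
proof (rule inj_onI)
  fix R R' assume R: "R \<in> curve - {Some (y1, z1)}" "R' \<in> curve - {Some (y1, z1)}"
    and eq: "to_infinity (Some (y1, z1)) R = to_infinity (Some (y1, z1)) R'"
  let ?f = "to_infinity (Some (y1, z1))"
  have "herm R R' = herm (?f R) (?f R') * herm R (Some (y1, z1)) * herm (Some (y1, z1)) R'"
    using R by (intro to_infinity_herm[OF P, symmetric]) auto
  moreover have "herm (?f R) (?f R') = 0"
    using to_infinity_curve[OF P, of R] R eq herm_eq_0_iff by auto
  ultimately show "R = R'" using R herm_eq_0_iff by auto
qed

lemma bij_to_infinity:
  assumes P: "Some (y1, z1) \<in> curve"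
  shows "bij_betw (to_infinity (Some (y1, z1))) (curve - {Some (y1, z1)}) (curve - {None})"
proof -
  let ?f = "to_infinity (Some (y1, z1))" and ?A = "curve - {Some (y1, z1)}"
  have "card (?f ` ?A) = card ?A" using inj_to_infinity[OF P] by (rule card_image)
  also have "\<dots> = card (curve - {None})" using P card_curve by simp
  finally have "?f ` ?A = curve - {None}"
    using to_infinity_curve[OF P] card_curve by (intro card_subset_eq image_subsetI) blast+
  with inj_to_infinity[OF P] show ?thesis by (simp add: bij_betw_def)
qed

text \<open>Sending \<open>P\<close> to infinity reduces the count to \<open>card_tri_None\<close>.
  The exceptional equation is the collinearity of \<open>(P, u)\<close> and
  \<open>(P', u')\<close>.\<close>

lemma card_tri:
  assumes P: "P \<in> curve" "P' \<in> curve" "P \<noteq> P'"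
    and u: "u \<noteq> 0" "u' \<noteq> 0" "u ^ (q + 1) = u' ^ (q + 1)"
  shows "card (tri P P' u u') = (if u * herm P' P = - (u' * herm P P') then q - 1 else q\<^sup>2 - 1)"
proof (cases P)
  case None
  with P obtain y0 z0 where P': "P' = Some (y0, z0)" by (cases P') auto
  show ?thesis using card_tri_None[of y0 z0, OF _ u] P by (simp add: None P')
next
  case (Some p)
  obtain y1 z1 where P1: "P = Some (y1, z1)" using Some by (cases p) auto
  note Pc = P(1)[unfolded P1]
  define f where "f = to_infinity P"
  have bij: "bij_betw f (curve - {P}) (curve - {None})"
    unfolding f_def P1 by (rule bij_to_infinity[OF Pc])
  have fP': "f P' \<in> curve - {None}" using bij_betwE[OF bij] P by blast
  then obtain y0 z0 where f0: "f P' = Some (y0, z0)" by (cases "f P'") auto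
  \<comment> \<open>The scale factors of \<open>to_infinity_herm\<close> go into new multipliers.
    Their norms still agree, since \<open>herm P P'\<close> and \<open>herm P' P\<close> are
    conjugate.\<close>
  define v where "v = u * herm P' P"
  define v' where "v' = u' * herm P P'"
  have nz: "herm P' P \<noteq> 0" "herm P P' \<noteq> 0" using herm_eq_0_iff P by auto
  have "herm P P' ^ (q + 1) = (herm P' P) ^ (q + 1)"
    using herm_frob[OF P(1,2)] herm_frob[OF P(2,1)] by simp
  then have v: "v \<noteq> 0" "v' \<noteq> 0" "v ^ (q + 1) = v' ^ (q + 1)"
    using u nz by (simp_all add: v_def v'_def power_mult_distrib del: power_Suc)
  have key: "f R \<in> tri None (f P') v v' \<longleftrightarrow> R \<in> tri P P' u u'" if R: "R \<in> curve - {P}" for R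
  proof -
    have h: "herm (f R1) (f R2) * herm R1 P * herm P R2 = herm R1 R2"
      if "R1 \<in> curve - {P}" "R2 \<in> curve - {P}" for R1 R2
      using that unfolding f_def P1 by (intro to_infinity_herm[OF Pc]) auto
    have P'': "P' \<in> curve - {P}" using P by auto
    have fR: "f R \<in> curve - {None}" using bij_betwE[OF bij] R by blast
    have c: "herm P R * herm R P \<noteq> 0" using herm_eq_0_iff P R by auto
    have inj: "f R = f P' \<longleftrightarrow> R = P'" using bij R P'' by (auto simp: bij_betw_def inj_on_def)
    obtain r where r: "f R = Some r" using fR by auto
    have n: "herm None (f R) = 1" "herm (f R) None = 1" unfolding r by (cases r; simp)+
    have "u * (herm R P * herm P' R) = v * herm (f P') (f R) * (herm P R * herm R P)"
      unfolding v_def h[OF P'' R, symmetric] by (simp only: mult_ac)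
    moreover have "u' * (herm P R * herm R P') = v' * herm (f R) (f P') * (herm P R * herm R P)"
      unfolding v'_def h[OF R P'', symmetric] by (simp only: mult_ac)
    ultimately have "u * (herm R P * herm P' R) = u' * (herm P R * herm R P')
        \<longleftrightarrow> v * herm (f P') (f R) = v' * herm (f R) (f P')"
      using c by (metis mult_cancel_right)
    with fR R inj n show ?thesis by (simp add: tri_def)
  qed
  have "bij_betw f (tri P P' u u') (tri None (f P') v v')"
  proof (rule bij_betw_subset[OF bij])
    show "tri P P' u u' \<subseteq> curve - {P}" by (auto simp: tri_def)
    show "f ` tri P P' u u' = tri None (f P') v v'"
    proof (intro subset_antisym subsetI)
      fix S assume S: "S \<in> tri None (f P') v v'"
      then have "S \<in> curve - {None}" by (auto simp: tri_def)
      then obtain R where R: "R \<in> curve - {P}" "S = f R" using bij by (auto simp: bij_betw_def)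
      with S key show "S \<in> f ` tri P P' u u'" by auto
    next
      fix S assume "S \<in> f ` tri P P' u u'"
      then obtain R where R: "R \<in> tri P P' u u'" "S = f R" by auto
      moreover have "R \<in> curve - {P}" using R by (auto simp: tri_def)
      ultimately show "S \<in> tri None (f P') v v'" using key by simp
    qed
  qed
  then have "card (tri P P' u u') = card (tri None (f P') v v')" by (rule bij_betw_same_card)
  also have "\<dots> = (if v = - v' then q - 1 else q\<^sup>2 - 1)"
    unfolding f0 using fP' v by (intro card_tri_None) (auto simp: f0)
  finally show ?thesis by (simp only: v_def v'_def)
qed

section \<open>The generalized quadrangle and its collinearity counts\<close>

definition unitary :: "'a set" where "unitary = {u. u ^ (q + 1) = 1}"

lemma card_unitary: "finite unitary" "card unitary = q + 1"
  unfolding unitary_def using card_norm_fibre[of 1] by simp_all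

lemma unitary_nonzero: "u \<in> unitary \<Longrightarrow> u \<noteq> 0"
  by (auto simp: unitary_def)

text \<open>The pair \<open>(P, u)\<close> stands for the points spanned over the subfield of order \<open>q\<close> by the
  vectors \<open>s P\<close> with \<open>s ^ (q - 1) = u\<close>; collinearity is the vanishing of the trace of the
  Hermitian product, divided by a nonzero factor.\<close>

definition points :: "(('a \<times> 'a) option \<times> 'a) set" where "points = curve \<times> unitary"

definition collinear :: "('a \<times> 'a) option \<times> 'a \<Rightarrow> ('a \<times> 'a) option \<times> 'a \<Rightarrow> bool" where
  "collinear = (\<lambda>(P, u) (P', u'). if P = P' then u \<noteq> u' else u * herm P' P = - (u' * herm P P'))"

text \<open>For \<open>R\<close> other than \<open>P\<close>, the second component of the only point
  on the spread line over \<open>R\<close> that is collinear with \<open>(P, u)\<close>.\<close>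

definition partner :: "('a \<times> 'a) option \<Rightarrow> 'a \<Rightarrow> ('a \<times> 'a) option \<Rightarrow> 'a" where
  "partner P u R = - (u * herm R P / herm P R)"

lemma finite_points: "finite points"
  using card_curve card_unitary by (simp add: points_def)

lemma card_points: "card points = (q ^ 3 + 1) * (q + 1)"
  unfolding points_def card_cartesian_product card_curve card_unitary ..

lemma collinear_irrefl: "\<not> collinear x x"
  by (auto simp: collinear_def)

lemma collinear_sym: "collinear x y \<Longrightarrow> collinear y x"
  by (auto simp: collinear_def split: if_splits)

lemma collinear_iff_partner:
  assumes "P \<in> curve" "R \<in> curve" "P \<noteq> R"
  shows "collinear (P, u) (R, w) \<longleftrightarrow> w = partner P u R"
proof -
  have "herm P R \<noteq> 0" using assms herm_eq_0_iff by simp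
  then have "w = partner P u R \<longleftrightarrow> w * herm P R = - (u * herm R P)"
    unfolding partner_def by (metis minus_divide_left nonzero_eq_divide_eq)
  moreover have "w * herm P R = - (u * herm R P) \<longleftrightarrow> u * herm R P = - (w * herm P R)"
    by (metis minus_minus)
  ultimately show ?thesis using assms(3) by (simp add: collinear_def)
qed

text \<open>\<open>herm R P\<close> and \<open>herm P R\<close> are conjugate, so their quotient has
  norm 1; the sign does not change the norm.\<close>

lemma partner_unitary:
  assumes "P \<in> curve" "R \<in> curve" "P \<noteq> R" "u \<in> unitary"
  shows "partner P u R \<in> unitary"
proof -
  have nz: "herm P R \<noteq> 0" using assms herm_eq_0_iff by simp
  have "herm R P ^ (q + 1) = herm P R ^ (q + 1)"
    using herm_frob[OF assms(1,2)] herm_frob[OF assms(2,1)] by simp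
  then have "partner P u R ^ (q + 1) = u ^ (q + 1)"
    unfolding partner_def neg_power_Suc_q power_divide power_mult_distrib using nz
    by (simp del: power_Suc add: power_not_zero)
  with assms(4) show ?thesis by (simp add: unitary_def)
qed

text \<open>The spread line of \<open>x\<close> has q further points, and over each of the q^3 other
  curve points lies exactly one neighbour, the partner.\<close>

lemma card_collinear:
  assumes "x \<in> points"
  shows "card {y \<in> points. collinear x y} = q ^ 3 + q"
proof -
  obtain P u where x: "x = (P, u)" and P: "P \<in> curve" and u: "u \<in> unitary"
    using assms by (auto simp: points_def)
  have "{y \<in> points. collinear x y}
      = {P} \<times> (unitary - {u}) \<union> (\<lambda>R. (R, partner P u R)) ` (curve - {P})" (is "_ = ?A \<union> ?B")
  proof (rule Set.set_eqI)
    fix y :: "('a \<times> 'a) option \<times> 'a"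
    obtain R w where y: "y = (R, w)" by (cases y)
    show "y \<in> {y \<in> points. collinear x y} \<longleftrightarrow> y \<in> ?A \<union> ?B"
    proof (cases "R = P")
      case True
      with P show ?thesis by (auto simp: x y points_def collinear_def)
    next
      case False
      with P u show ?thesis
        by (auto simp: x y points_def collinear_iff_partner partner_unitary)
    qed
  qed
  moreover have "card ?A = q" using u card_unitary by simp
  moreover have "card ?B = q ^ 3"
    using P card_curve by (subst card_image) (auto simp: inj_on_def)
  moreover have "finite ?A" "finite ?B" "?A \<inter> ?B = {}" using card_curve card_unitary by auto
  ultimately show ?thesis by (simp only: card_Un_disjoint)
qed

text \<open>Two points of one spread line share its other q - 1 points and nothing else, as their
  partners always differ. Otherwise \<open>tri\<close> counts the common neighbours off the two
  spread lines; noncollinear points have one more on each of these, which turns q^2 - 1 into q^2 +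
  1.\<close>

lemma card_common_collinear:
  assumes "x \<in> points" "y \<in> points" "x \<noteq> y"
  shows "card {z \<in> points. collinear x z \<and> collinear y z} = (if collinear x y then q - 1 else q\<^sup>2 + 1)"
proof -
  obtain P u where x: "x = (P, u)" and P: "P \<in> curve" and u: "u \<in> unitary"
    using assms by (auto simp: points_def)
  obtain P' u' where y: "y = (P', u')" and P': "P' \<in> curve" and u': "u' \<in> unitary"
    using assms by (auto simp: points_def)
  let ?N = "{z \<in> points. collinear x z \<and> collinear y z}"
  show ?thesis
  proof (cases "P = P'")
    case True
    with assms(3) have "u \<noteq> u'" by (simp add: x y)
    have "?N = {P} \<times> (unitary - {u, u'})"
    proof (rule Set.set_eqI)
      fix z :: "('a \<times> 'a) option \<times> 'a"
      obtain R w where z: "z = (R, w)" by (cases z)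
      show "z \<in> ?N \<longleftrightarrow> z \<in> {P} \<times> (unitary - {u, u'})"
      proof (cases "R = P")
        case True
        with P \<open>P = P'\<close> show ?thesis by (auto simp: x y z points_def collinear_def)
      next
        case False
        have "partner P u R \<noteq> partner P u' R" if "R \<in> curve"
          using that P False \<open>u \<noteq> u'\<close> herm_eq_0_iff by (simp add: partner_def)
        with P False \<open>P = P'\<close> show ?thesis
          by (auto simp: x y z points_def collinear_iff_partner)
      qed
    qed
    then have "card ?N = q - 1" using u u' \<open>u \<noteq> u'\<close> card_unitary by (simp add: card_Diff_subset)
    moreover have "collinear x y" using True \<open>u \<noteq> u'\<close> by (simp add: x y collinear_def)
    ultimately show ?thesis by simp
  next
    case False
    \<comment> \<open>Over \<open>P\<close> itself \<open>partner P u P\<close> would divide by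
      zero, so the component there comes from the other point. If \<open>x\<close> and
      \<open>y\<close> are collinear, the candidates over \<open>P\<close> and \<open>P'\<close> are
      \<open>x\<close> and \<open>y\<close> themselves, whence the empty \<open>E\<close>.\<close>
    define g where "g R = (R, if R = P then partner P' u' P else partner P u R)" for R
    define E where "E = (if collinear x y then {} else {P, P'})"
    have col: "collinear x y \<longleftrightarrow> u * herm P' P = - (u' * herm P P')"
      using False by (simp add: x y collinear_def)
    have col': "collinear x y \<longleftrightarrow> u' = partner P u P'" "collinear x y \<longleftrightarrow> u = partner P' u' P"
      using collinear_iff_partner[OF P P' False, of u u'] collinear_iff_partner[OF P' P, of u' u] False
        collinear_sym[of x y] collinear_sym[of y x] by (auto simp: x y)
    have tri: "R \<in> tri P P' u u' \<longleftrightarrow> R \<in> curve - {P, P'} \<and> partner P u R = partner P' u' R" for R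
    proof (cases "R \<in> curve - {P, P'}")
      case True
      then have "herm P R \<noteq> 0" "herm P' R \<noteq> 0" using P P' herm_eq_0_iff by auto
      with True show ?thesis
        by (simp add: tri_def partner_def frac_eq_eq) (simp only: mult_ac)
    qed (auto simp: tri_def)
    have "?N = g ` (tri P P' u u' \<union> E)"
    proof (rule Set.set_eqI)
      fix z :: "('a \<times> 'a) option \<times> 'a"
      obtain R w where z: "z = (R, w)" by (cases z)
      have gz: "z \<in> g ` M \<longleftrightarrow> R \<in> M \<and> w = (if R = P then partner P' u' P else partner P u R)" for M
        by (auto simp: z g_def)
      consider "R = P" | "R = P'" | "R \<notin> {P, P'}" by blast
      then show "z \<in> ?N \<longleftrightarrow> z \<in> g ` (tri P P' u u' \<union> E)"
      proof cases
        case 1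
        have "z \<in> ?N \<longleftrightarrow> w = partner P' u' P \<and> w \<noteq> u"
          using 1 P P' False u' partner_unitary[OF P' P _ u']
          by (auto simp: z x y points_def collinear_iff_partner) (auto simp: collinear_def)
        also have "\<dots> \<longleftrightarrow> z \<in> g ` (tri P P' u u' \<union> E)"
          using 1 col' unfolding gz by (auto simp: tri E_def)
        finally show ?thesis .
      next
        case 2
        have "z \<in> ?N \<longleftrightarrow> w = partner P u P' \<and> w \<noteq> u'"
          using 2 P P' False u partner_unitary[OF P P' False u]
          by (auto simp: z x y points_def collinear_iff_partner) (auto simp: collinear_def)
        also have "\<dots> \<longleftrightarrow> z \<in> g ` (tri P P' u u' \<union> E)"
          using 2 False col' unfolding gz by (auto simp: tri E_def)
        finally show ?thesis .
      next
        case 3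
        then show ?thesis
          unfolding gz using P P' u partner_unitary[OF P _ _ u, of R]
          by (auto simp: z x y points_def collinear_iff_partner tri E_def)
      qed
    qed
    moreover have "inj_on g A" for A by (auto simp: inj_on_def g_def)
    ultimately have "card ?N = card (tri P P' u u' \<union> E)" by (simp add: card_image)
    also have "\<dots> = card (tri P P' u u') + card E"
      using finite_tri by (intro card_Un_disjoint) (auto simp: tri_def E_def)
    also have "card (tri P P' u u') = (if collinear x y then q - 1 else q\<^sup>2 - 1)"
      unfolding col using u u' by (intro card_tri P P' False unitary_nonzero) (simp_all add: unitary_def)
    finally show ?thesis using False q_ge_2 by (auto simp: E_def Suc_leI)
  qed
qed

end

section \<open>Gram matrices, packings and graphs\<close>

text \<open>Since \<open>G / c\<close> is an orthogonal projection, the scaled rows of \<open>G\<close> have Gram matrix \<open>G\<close>, and by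
  Parseval's identity the dimension of their span is the trace of \<open>G / c\<close>.\<close>

lemma gram_realization:
  fixes G :: "'v \<Rightarrow> 'v \<Rightarrow> real"
  assumes V: "finite V" "card V \<le> DIM('b::euclidean_space)"
    and sym: "\<And>x y. G x y = G y x"
    and sq: "\<And>x y. x \<in> V \<Longrightarrow> y \<in> V \<Longrightarrow> (\<Sum>z\<in>V. G x z * G z y) = c * G x y"
    and c: "c > 0" and trace: "(\<Sum>x\<in>V. G x x) = c * DIM('d::euclidean_space)"
  obtains f :: "'v \<Rightarrow> 'd::euclidean_space" where "\<And>x y. x \<in> V \<Longrightarrow> y \<in> V \<Longrightarrow> inner (f x) (f y) = G x y"
proof -
  \<comment> \<open>The space \<open>'b\<close> supplies orthonormal vectors indexed by
    \<open>V\<close>, with respect to which the rows of \<open>G\<close> become vectors.\<close>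
  obtain e :: "'v \<Rightarrow> 'b" where e: "inj_on e V" "e ` V \<subseteq> Basis"
    using card_le_inj[OF V(1) finite_Basis V(2)] by blast
  have ee: "inner (e x) (e y) = (if x = y then 1 else 0)" if "x \<in> V" "y \<in> V" for x y
    using that e by (auto simp: inner_Basis inj_on_def image_subset_iff)
  define g where "g x = (1 / sqrt c) *\<^sub>R (\<Sum>z\<in>V. G x z *\<^sub>R e z)" for x
  have gg: "inner (g x) (g y) = G x y" if xy: "x \<in> V" "y \<in> V" for x y
  proof -
    have "inner (\<Sum>z\<in>V. G x z *\<^sub>R e z) (\<Sum>w\<in>V. G y w *\<^sub>R e w)
        = (\<Sum>z\<in>V. \<Sum>w\<in>V. G x z * (G y w * inner (e z) (e w)))"
      unfolding inner_sum_left unfolding inner_sum_right by (simp add: mult_ac)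
    also have "\<dots> = (\<Sum>z\<in>V. \<Sum>w\<in>V. if w = z then G x z * G z y else 0)"
      by (intro sum.cong refl) (simp add: ee sym[of y])
    also have "\<dots> = c * G x y" using V sq[OF xy] by simp
    finally show ?thesis
      using c by (simp add: g_def)
  qed
  \<comment> \<open>Since the square of \<open>G\<close> is \<open>c\<close> times \<open>G\<close>,
    the vectors \<open>g x\<close> form a tight frame of their span with bound
    \<open>c\<close>.\<close>
  have frame: "(\<Sum>x\<in>V. inner (g x) v *\<^sub>R g x) = c *\<^sub>R v" if "v \<in> span (g ` V)" for v
    using that
  proof (induction rule: span_induct_alt)
    case base
    show ?case by simp
  next
    case (step r u v)
    then obtain y where y: "y \<in> V" "u = g y" by auto
    have "(\<Sum>x\<in>V. inner (g x) (g y) *\<^sub>R g x)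
        = (\<Sum>x\<in>V. G y x *\<^sub>R g x)"
      by (intro sum.cong refl) (simp add: gg y sym[of y])
    also have "\<dots> = (1 / sqrt c) *\<^sub>R (\<Sum>x\<in>V. \<Sum>z\<in>V. (G y x * G x z) *\<^sub>R e z)"
      by (simp add: g_def scaleR_sum_right mult_ac)
    also have "(\<Sum>x\<in>V. \<Sum>z\<in>V. (G y x * G x z) *\<^sub>R e z) = (\<Sum>z\<in>V. (\<Sum>x\<in>V. G y x * G x z) *\<^sub>R e z)"
      by (subst sum.swap) (simp add: scaleR_sum_left)
    also have "\<dots> = c *\<^sub>R (\<Sum>z\<in>V. G y z *\<^sub>R e z)"
      unfolding scaleR_sum_right by (intro sum.cong refl) (simp add: sq y)
    finally have "(\<Sum>x\<in>V. inner (g x) (g y) *\<^sub>R g x) = c *\<^sub>R g y" by (simp add: g_def)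
    then have "(\<Sum>x\<in>V. inner (g x) u *\<^sub>R g x) = c *\<^sub>R u" by (simp only: y(2))
    moreover have "(\<Sum>x\<in>V. inner (g x) (r *\<^sub>R u + v) *\<^sub>R g x)
        = r *\<^sub>R (\<Sum>x\<in>V. inner (g x) u *\<^sub>R g x) + (\<Sum>x\<in>V. inner (g x) v *\<^sub>R g x)"
      by (simp add: inner_add_right scaleR_add_left sum.distrib scaleR_sum_right)
    ultimately show ?case using step.IH by (simp add: scaleR_add_right mult.commute)
  qed
  obtain B where B: "B \<subseteq> span (g ` V)" "pairwise orthogonal B" "\<And>x. x \<in> B \<Longrightarrow> norm x = 1"
      "independent B" "card B = dim (span (g ` V))" "span B = span (g ` V)"
    by (rule orthonormal_basis_subspace[OF subspace_span[of "g ` V"]]) (rule that)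
  have finB: "finite B" using B(4) by (rule independent_imp_finite)
  \<comment> \<open>Applying the frame identity to an orthonormal basis and exchanging the sums
    turns \<open>c * card B\<close> into the trace of \<open>G\<close>.\<close>
  have "c * card B = (\<Sum>b\<in>B. inner (c *\<^sub>R b) b)"
    using B(3) by (simp add: dot_square_norm)
  also have "\<dots> = (\<Sum>b\<in>B. \<Sum>x\<in>V. inner (g x) b * inner (g x) b)"
    using B(1) by (intro sum.cong refl, subst frame[symmetric]) (auto simp: inner_sum_left)
  also have "\<dots> = (\<Sum>x\<in>V. inner (\<Sum>b\<in>B. inner (g x) b *\<^sub>R b) (g x))"
    unfolding inner_sum_left inner_scaleR_left
    by (subst sum.swap) (intro sum.cong refl arg_cong2[where f = "(*)"] inner_commute)
  also have "\<dots> = (\<Sum>x\<in>V. inner (g x) (g x))"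
    using B finB by (intro sum.cong refl) (simp add: orthonormal_basis_expand span_base)
  also have "\<dots> = c * DIM('d)" using trace by (simp add: gg)
  finally have "dim (span (g ` V)) \<le> dim (UNIV :: 'd set)" using c B(5) by simp
  then obtain h :: "'b \<Rightarrow> 'd" where h: "linear h" "\<And>x. x \<in> span (g ` V) \<Longrightarrow> norm (h x) = norm x"
    by (rule isometry_subset_subspace[OF subspace_span subspace_UNIV]) (rule that)
  \<comment> \<open>Norms on the span determine inner products by polarization.\<close>
  have "inner (h (g x)) (h (g y)) = G x y" if xy: "x \<in> V" "y \<in> V" for x y
  proof -
    have s: "g x \<in> span (g ` V)" "g y \<in> span (g ` V)" using xy by (auto intro: span_base)
    then have "norm (h (g x + g y)) = norm (g x + g y)" by (intro h(2) span_add)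
    with s show ?thesis
      using gg[OF xy] by (simp add: dot_norm linear_add[OF h(1)] h(2))
  qed
  then show thesis by (rule that)
qed

section \<open>Packings of balls of equal radius\<close>

lemma ball_disjoint_iff:
  fixes x y :: "'a::euclidean_space"
  assumes "r > 0"
  shows "ball x r \<inter> ball y r = {} \<longleftrightarrow> dist x y \<ge> 2 * r"
proof
  show "dist x y \<ge> 2 * r" if "ball x r \<inter> ball y r = {}"
  proof (rule ccontr)
    assume "\<not> dist x y \<ge> 2 * r"
    then have "midpoint x y \<in> ball x r \<inter> ball y r" by (simp add: dist_midpoint)
    with that show False by blast
  qed
qed (simp add: disjoint_ballI)

lemma cball_meet_iff:
  fixes x y :: "'a::euclidean_space"
  shows "cball x r \<inter> cball y r \<noteq> {} \<longleftrightarrow> dist x y \<le> 2 * r"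
proof
  show "cball x r \<inter> cball y r \<noteq> {}" if "dist x y \<le> 2 * r"
  proof -
    have "midpoint x y \<in> cball x r \<inter> cball y r" using that by (simp add: dist_midpoint)
    then show ?thesis by blast
  qed
qed (use disjoint_cballI[of r r x y] in fastforce)

lemma tangent_cball_iff:
  fixes x y :: "'a::euclidean_space"
  assumes "r > 0"
  shows "tangent (cball x r) (cball y r) \<longleftrightarrow> dist x y = 2 * r"
  unfolding tangent_def interior_cball ball_disjoint_iff[OF assms] cball_meet_iff by auto

lemma unit_ball_packing_image:
  fixes f :: "'v \<Rightarrow> 'a::euclidean_space"
  assumes "r > 0" "\<And>x y. x \<in> V \<Longrightarrow> y \<in> V \<Longrightarrow> x \<noteq> y \<Longrightarrow> dist (f x) (f y) \<ge> 2 * r"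
  shows "unit_ball_packing ((\<lambda>x. cball (f x) r) ` V)"
  unfolding unit_ball_packing_def ball_packing_def pairwise_image
  using assms by (auto simp: pairwise_def interior_cball ball_disjoint_iff)

section \<open>Transport, complements and colourings of graphs\<close>

lemma colorable_image:
  assumes inj: "inj_on g V" and adj: "\<And>x y. x \<in> V \<Longrightarrow> y \<in> V \<Longrightarrow> adj' (g x) (g y) \<longleftrightarrow> adj x y"
  shows "colorable (g ` V) adj' n \<longleftrightarrow> colorable V adj n"
proof
  assume "colorable (g ` V) adj' n"
  then obtain c :: "_ \<Rightarrow> nat" where
    "\<forall>x\<in>g ` V. c x < n" "\<forall>x\<in>g ` V. \<forall>y\<in>g ` V. adj' x y \<longrightarrow> c x \<noteq> c y"
    unfolding colorable_def by blast
  then show "colorable V adj n"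
    unfolding colorable_def using adj by (intro exI[of _ "c \<circ> g"]) auto
next
  assume "colorable V adj n"
  then obtain c :: "_ \<Rightarrow> nat" where "\<forall>x\<in>V. c x < n" "\<forall>x\<in>V. \<forall>y\<in>V. adj x y \<longrightarrow> c x \<noteq> c y"
    unfolding colorable_def by blast
  then show "colorable (g ` V) adj' n"
    unfolding colorable_def using adj inj
    by (intro exI[of _ "c \<circ> the_inv_into V g"]) (auto simp: the_inv_into_f_f)
qed

lemma strongly_regular_image:
  assumes inj: "inj_on g V" and adj: "\<And>x y. x \<in> V \<Longrightarrow> y \<in> V \<Longrightarrow> adj' (g x) (g y) \<longleftrightarrow> adj x y"
    and srg: "strongly_regular V adj v k l m"
  shows "strongly_regular (g ` V) adj' v k l m"
proof -
  have card_eq: "card {y \<in> g ` V. Q y} = card {y \<in> V. Q (g y)}" for Q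
  proof -
    have "{y \<in> g ` V. Q y} = g ` {y \<in> V. Q (g y)}" by auto
    then show ?thesis using inj by (simp add: card_image inj_on_subset)
  qed
  have "card {y \<in> V. adj' (g x) (g y)} = card {y \<in> V. adj x y}" if "x \<in> V" for x
    using adj that by (intro arg_cong[where f = card]) auto
  moreover have "card {z \<in> V. adj' (g x) (g z) \<and> adj' (g y) (g z)} = card {z \<in> V. adj x z \<and> adj y z}"
    if "x \<in> V" "y \<in> V" for x y
    using adj that by (intro arg_cong[where f = card]) auto
  ultimately have
    "\<forall>x\<in>V. card {y \<in> g ` V. adj' (g x) y} = k"
    "\<forall>x\<in>V. \<forall>y\<in>V. adj' (g x) (g y) \<longrightarrow> card {z \<in> g ` V. adj' (g x) z \<and> adj' (g y) z} = l"
    "\<forall>x\<in>V. \<forall>y\<in>V. g x \<noteq> g y \<and> \<not> adj' (g x) (g y) \<longrightarrow>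
       card {z \<in> g ` V. adj' (g x) z \<and> adj' (g y) z} = m"
    using srg adj unfolding card_eq strongly_regular_def by auto
  moreover have "finite_simple_graph (g ` V) adj'"
    using srg adj unfolding strongly_regular_def finite_simple_graph_def by simp
  moreover have "card (g ` V) = v"
    using srg inj unfolding strongly_regular_def by (simp add: card_image)
  ultimately show ?thesis unfolding strongly_regular_def ball_simps by blast
qed

text \<open>Inclusion-exclusion gives the size of the union of two neighbourhoods. Adjacent
  \<open>x\<close> and \<open>y\<close> already lie in this union; nonadjacent ones do not and must
  be removed as well, hence the 2.\<close>

lemma strongly_regular_complement:
  assumes srg: "strongly_regular V adj v k l m"
  shows "strongly_regular V (\<lambda>x y. x \<noteq> y \<and> \<not> adj x y) v (v - (k + 1)) (v - (2 * k - m + 2)) (v - (2 * k - l))"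
proof -
  define N where "N x = {y \<in> V. adj x y}" for x
  have fin: "finite V" and irrefl: "\<And>x. x \<in> V \<Longrightarrow> \<not> adj x x"
    and sym: "\<And>x y. x \<in> V \<Longrightarrow> y \<in> V \<Longrightarrow> adj x y \<Longrightarrow> adj y x" and card: "card V = v"
    and k: "\<And>x. x \<in> V \<Longrightarrow> card (N x) = k"
    using srg by (auto simp: strongly_regular_def finite_simple_graph_def N_def)
  have lm: "card (N x \<inter> N y) = (if adj x y then l else m)" if "x \<in> V" "y \<in> V" "x \<noteq> y" for x y
  proof -
    have "N x \<inter> N y = {z \<in> V. adj x z \<and> adj y z}" by (auto simp: N_def)
    then show ?thesis using srg that by (auto simp: strongly_regular_def)
  qed
  have finN: "finite (N x)" for x using fin by (simp add: N_def)
  have union: "card (N x \<union> N y) = 2 * k - (if adj x y then l else m)" if "x \<in> V" "y \<in> V" "x \<noteq> y" for x y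
    using card_Un_Int[OF finN finN, of x y] k that lm[OF that] by simp
  have sub: "N x \<subseteq> V" for x by (auto simp: N_def)
  have reg: "card {y \<in> V. x \<noteq> y \<and> \<not> adj x y} = v - (k + 1)" if x: "x \<in> V" for x
  proof -
    have "{y \<in> V. x \<noteq> y \<and> \<not> adj x y} = V - insert x (N x)" by (auto simp: N_def)
    moreover have "card (insert x (N x)) = k + 1" using x irrefl k finN by (simp add: N_def)
    ultimately show ?thesis using x sub finN card by (simp add: card_Diff_subset)
  qed
  have common: "card {z \<in> V. (x \<noteq> z \<and> \<not> adj x z) \<and> (y \<noteq> z \<and> \<not> adj y z)}
      = (if adj x y then v - (2 * k - l) else v - (2 * k - m + 2))"
    if xy: "x \<in> V" "y \<in> V" "x \<noteq> y" for x y
  proof -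
    let ?U = "insert x (insert y (N x \<union> N y))"
    have "{z \<in> V. (x \<noteq> z \<and> \<not> adj x z) \<and> (y \<noteq> z \<and> \<not> adj y z)} = V - ?U" by (auto simp: N_def)
    moreover have "card ?U = (if adj x y then 2 * k - l else 2 * k - m + 2)"
    proof (cases "adj x y")
      case True
      with xy sym have "?U = N x \<union> N y" by (auto simp: N_def)
      with True union[OF xy] show ?thesis by simp
    next
      case False
      with xy sym irrefl have "x \<notin> insert y (N x \<union> N y)" "y \<notin> N x \<union> N y" by (auto simp: N_def)
      with False union[OF xy] finN show ?thesis by simp
    qed
    moreover have "?U \<subseteq> V" "finite ?U" using xy sub finN by auto
    ultimately show ?thesis using card by (simp add: card_Diff_subset)
  qed
  show ?thesis
    unfolding strongly_regular_def finite_simple_graph_def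
    using fin sym card reg common by (auto simp: conj_assoc)
qed

text \<open>The colour classes cover \<open>V\<close> and are independent.\<close>

lemma card_le_colors_times_independent:
  assumes "finite V" "colorable V adj n"
    and indep: "\<And>A. A \<subseteq> V \<Longrightarrow> (\<And>x y. x \<in> A \<Longrightarrow> y \<in> A \<Longrightarrow> \<not> adj x y) \<Longrightarrow> card A \<le> s"
  shows "card V \<le> n * s"
proof -
  obtain c :: "'a \<Rightarrow> nat" where c: "\<forall>x\<in>V. c x < n" "\<forall>x\<in>V. \<forall>y\<in>V. adj x y \<longrightarrow> c x \<noteq> c y"
    using assms(2) unfolding colorable_def by blast
  have "V = (\<Union>i<n. {x \<in> V. c x = i})" using c(1) by auto
  then have "card V \<le> (\<Sum>i<n. card {x \<in> V. c x = i})"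
    using card_UN_le[of "{..<n}" "\<lambda>i. {x \<in> V. c x = i}"] by simp
  also have "\<dots> \<le> (\<Sum>i<n. s)" using c(2) by (intro sum_mono indep) (auto, metis)
  finally show ?thesis by simp
qed

section \<open>The noncollinearity graph and its realization by balls\<close>

context frobenius
begin

abbreviation noncollinear :: "('a \<times> 'a) option \<times> 'a \<Rightarrow> ('a \<times> 'a) option \<times> 'a \<Rightarrow> bool" where
  "noncollinear x y \<equiv> x \<noteq> y \<and> \<not> collinear x y"

lemma strongly_regular_collinear:
  "strongly_regular points collinear ((q ^ 3 + 1) * (q + 1)) (q ^ 3 + q) (q - 1) (q\<^sup>2 + 1)"
proof -
  have "card {z \<in> points. collinear x z \<and> collinear y z} = q - 1"
    if "x \<in> points" "y \<in> points" "collinear x y" for x y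
    using card_common_collinear[of x y] that collinear_irrefl by metis
  then show ?thesis
    unfolding strongly_regular_def finite_simple_graph_def
    using finite_points collinear_irrefl collinear_sym card_points card_collinear card_common_collinear
    by simp
qed

text \<open>Once two distinct points are chosen, all others are among their q - 1 common
  neighbours.\<close>

lemma card_clique:
  assumes A: "A \<subseteq> points" and clique: "\<And>x y. x \<in> A \<Longrightarrow> y \<in> A \<Longrightarrow> \<not> noncollinear x y"
  shows "card A \<le> q + 1"
proof (cases "\<exists>x\<in>A. \<exists>y\<in>A. x \<noteq> y")
  case True
  then obtain x y where xy: "x \<in> A" "y \<in> A" "x \<noteq> y" by blast
  let ?N = "{z \<in> points. collinear x z \<and> collinear y z}"
  have col: "collinear z w" if "z \<in> A" "w \<in> A" "z \<noteq> w" for z w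
    using clique[OF that(1,2)] that(3) by blast
  have "A \<subseteq> insert x (insert y ?N)" using A col xy by blast
  then have "card A \<le> card (insert x (insert y ?N))"
    using finite_points by (intro card_mono) auto
  also have "\<dots> \<le> card ?N + 2" using finite_points by (simp add: card_insert_if)
  also have "card ?N = q - 1" using card_common_collinear[of x y] subsetD[OF A xy(1)] subsetD[OF A xy(2)] col[OF xy] xy(3) by simp
  finally show ?thesis using q_ge_2 by simp
next
  case False
  then have "A = {} \<or> (\<exists>x. A = {x})" by blast
  then show ?thesis by auto
qed

lemma chromatic_number_noncollinear: "chromatic_number points noncollinear = q ^ 3 + 1"
  unfolding chromatic_number_def
proof (rule Least_equality)
  \<comment> \<open>The colouring numbers the curve points, so that each colour class is a spread
    line.\<close>
  obtain c :: "_ \<Rightarrow> nat" where c: "bij_betw c curve {0..<card curve}"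
    using ex_bij_betw_finite_nat[OF card_curve(1)] by blast
  have pt: "fst x \<in> curve" if "x \<in> points" for x using that by (auto simp: points_def)
  have "c (fst x) < q ^ 3 + 1" if "x \<in> points" for x
    using bspec[OF bij_betwE[OF c] pt[OF that]] unfolding card_curve by simp
  moreover have "c (fst x) \<noteq> c (fst y)" if "x \<in> points" "y \<in> points" "noncollinear x y" for x y
  proof -
    have "fst x \<noteq> fst y" using that(3) by (cases x; cases y) (auto simp: collinear_def)
    then show ?thesis using inj_onD[OF bij_betw_imp_inj_on[OF c] _ pt pt] that(1,2) by blast
  qed
  ultimately show "colorable points noncollinear (q ^ 3 + 1)"
    unfolding colorable_def by (intro exI[of _ "c \<circ> fst"]) simp
next
  fix n assume col: "colorable points noncollinear n"
  have "card points \<le> n * (q + 1)"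
    by (rule card_le_colors_times_independent[OF finite_points col card_clique])
  then have "(q ^ 3 + 1) * (q + 1) \<le> n * (q + 1)" unfolding card_points .
  then show "q ^ 3 + 1 \<le> n" unfolding mult_le_cancel2 by simp
qed

text \<open>The eigenspace projection scaled by (q + 1)^2 / q, which makes the diagonal 1 and the
  realizing vectors unit vectors.\<close>

definition gram :: "('a \<times> 'a) option \<times> 'a \<Rightarrow> ('a \<times> 'a) option \<times> 'a \<Rightarrow> real" where
  "gram x y = (if x = y then 1 else if collinear x y then - 1 / q else 1 / q\<^sup>2)"

lemma gram_sym: "gram x y = gram y x"
  using collinear_sym by (auto simp: gram_def)

text \<open>The matrix is a combination of the identity, the all-one matrix and the adjacency
  matrix; strong regularity evaluates all products, and the identity is checked for equal, collinear
  and noncollinear pairs.\<close>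

lemma gram_square:
  assumes "x \<in> points" "y \<in> points"
  shows "(\<Sum>z\<in>points. gram x z * gram z y) = ((real q + 1)\<^sup>2 / q) * gram x y"
proof -
  define Q where "Q = real q"
  have Q: "Q > 0" using q_ge_2 by (simp add: Q_def)
  \<comment> \<open>Chosen so that \<open>\<alpha> + \<beta> = 1\<close> on the diagonal,
    \<open>\<beta> + \<gamma> = - 1 / Q\<close> for collinear pairs and
    \<open>\<beta> = 1 / Q\<^sup>2\<close> for the rest.\<close>
  define \<alpha> \<beta> \<gamma> where "\<alpha> = 1 - 1 / Q\<^sup>2" and "\<beta> = 1 / Q\<^sup>2" and "\<gamma> = - 1 / Q - 1 / Q\<^sup>2"
  define ind :: "bool \<Rightarrow> real" where "ind = of_bool"
  have ind: "ind True = 1" "ind False = 0" by (simp_all add: ind_def)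
  have gram: "gram z w = \<alpha> * ind (z = w) + \<beta> + \<gamma> * ind (collinear z w)" for z w
    by (auto simp: gram_def \<alpha>_def \<beta>_def \<gamma>_def Q_def collinear_irrefl ind_def)
  have sum_ind: "(\<Sum>z\<in>points. ind (R z)) = real (card {z \<in> points. R z})" for R
    using finite_points by (simp add: ind_def of_bool_def sum.If_cases Int_def)
  have k: "(\<Sum>z\<in>points. ind (collinear w z)) = Q ^ 3 + Q" if "w \<in> points" for w
    unfolding sum_ind card_collinear[OF that] by (simp add: Q_def)
  have one: "(\<Sum>z\<in>points. ind (z = w)) = 1" if "w \<in> points" for w
  proof -
    have "{z \<in> points. z = w} = {w}" using that by auto
    then show ?thesis unfolding sum_ind by simp
  qed
  define n where "n = (\<Sum>z\<in>points. ind (collinear x z \<and> collinear y z))"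
  have "gram x z * gram z y = \<alpha>\<^sup>2 * ind (x = y) * ind (z = x) + \<alpha> * \<beta> * (ind (z = x) + ind (z = y))
      + \<alpha> * \<gamma> * ind (collinear x y) * (ind (z = x) + ind (z = y))
      + \<beta> * \<beta> + \<beta> * \<gamma> * (ind (collinear x z) + ind (collinear y z))
      + \<gamma> * \<gamma> * ind (collinear x z \<and> collinear y z)" for z
  proof -
    have c: "collinear z y = collinear y z" "collinear y x = collinear x y"
      using collinear_sym by blast+
    have "ind (x = z) * ind (z = y) = ind (x = y) * ind (z = x)"
      "ind (x = z) * ind (collinear z y) = ind (collinear x y) * ind (z = x)"
      "ind (collinear x z) * ind (z = y) = ind (collinear x y) * ind (z = y)"
      "ind (collinear x z) * ind (collinear z y) = ind (collinear x z \<and> collinear y z)"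
      unfolding ind_def c(1) using c(2) by auto
    then have "\<alpha>\<^sup>2 * (ind (x = z) * ind (z = y)) + \<alpha> * \<gamma> * (ind (x = z) * ind (collinear z y))
        + \<alpha> * \<gamma> * (ind (collinear x z) * ind (z = y)) + \<gamma> * \<gamma> * (ind (collinear x z) * ind (collinear z y))
      = \<alpha>\<^sup>2 * (ind (x = y) * ind (z = x)) + \<alpha> * \<gamma> * (ind (collinear x y) * ind (z = x))
        + \<alpha> * \<gamma> * (ind (collinear x y) * ind (z = y)) + \<gamma> * \<gamma> * ind (collinear x z \<and> collinear y z)"
      by (simp only:)
    moreover have "ind (x = z) = ind (z = x)" by (simp add: eq_commute)
    ultimately show ?thesis unfolding gram c by (simp add: algebra_simps power2_eq_square)
  qed
  then have "(\<Sum>z\<in>points. gram x z * gram z y)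
      = \<alpha>\<^sup>2 * ind (x = y) * 1 + \<alpha> * \<beta> * (1 + 1)
      + \<alpha> * \<gamma> * ind (collinear x y) * (1 + 1)
      + \<beta> * (real (card points) * \<beta>) + \<beta> * \<gamma> * ((Q ^ 3 + Q) + (Q ^ 3 + Q)) + \<gamma> * \<gamma> * n"
    by (simp only: sum.distrib sum_distrib_left[symmetric] sum_constant k[OF assms(1)] k[OF assms(2)]
        one[OF assms(1)] one[OF assms(2)] n_def)
  moreover have "real (card points) = (Q ^ 3 + 1) * (Q + 1)" by (simp add: card_points Q_def algebra_simps)
  moreover have "n = (if x = y then Q ^ 3 + Q else if collinear x y then Q - 1 else Q\<^sup>2 + 1)"
    unfolding n_def sum_ind using card_collinear[OF assms(2)] card_common_collinear[OF assms] q_ge_2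
    by (simp add: Q_def of_nat_diff)
  ultimately have "(\<Sum>z\<in>points. gram x z * gram z y)
      = \<alpha>\<^sup>2 * ind (x = y) + \<alpha> * \<beta> * 2 + \<alpha> * \<gamma> * ind (collinear x y) * 2
      + \<beta> * \<beta> * ((Q ^ 3 + 1) * (Q + 1)) + \<beta> * \<gamma> * (2 * (Q ^ 3 + Q))
      + \<gamma> * \<gamma> * (if x = y then Q ^ 3 + Q else if collinear x y then Q - 1 else Q\<^sup>2 + 1)" (is "_ = ?S")
    by simp
  also have "?S = ((Q + 1)\<^sup>2 / Q) * gram x y"
  proof -
    consider "x = y" "\<not> collinear x y" | "x \<noteq> y" "collinear x y" | "x \<noteq> y" "\<not> collinear x y"
      using collinear_irrefl by blast
    then show ?thesis
    proof cases
      case 1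
      then have "gram x y = 1" by (simp add: gram_def)
      with 1 Q show ?thesis
        by (simp add: ind \<alpha>_def \<beta>_def \<gamma>_def) (simp add: field_simps eval_nat_numeral)
    next
      case 2
      then have "gram x y = - 1 / Q" by (simp add: gram_def Q_def)
      with 2 Q show ?thesis
        by (simp add: ind \<alpha>_def \<beta>_def \<gamma>_def) (simp add: field_simps eval_nat_numeral)
    next
      case 3
      then have "gram x y = 1 / Q\<^sup>2" by (simp add: gram_def Q_def)
      with 3 Q show ?thesis
        by (simp add: ind \<alpha>_def \<beta>_def \<gamma>_def) (simp add: field_simps eval_nat_numeral)
    qed
  qed
  finally show ?thesis by (simp add: Q_def)
qed

lemma packing_exists:
  assumes dim: "CARD('n::finite) = q ^ 3 - q ^ 2 + q"
  shows "\<exists>P :: (real ^ 'n) set set.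
           unit_ball_packing P \<and>
           (\<exists>v k l m. strongly_regular P tangent v k l m) \<and>
           chromatic_number P tangent = q ^ 3 + 1"
proof -
  have q3: "q ^ 2 \<le> q ^ 3" using q_ge_2 by (intro power_increasing) auto
  define Q where "Q = real q"
  have Q: "Q \<ge> 2" using q_ge_2 by (simp add: Q_def)
  have dimQ: "real CARD('n) = Q ^ 3 - Q\<^sup>2 + Q" using dim q3 by (simp add: of_nat_diff Q_def)
  \<comment> \<open>This uses Q^3 + 1 = (Q + 1)(Q^2 - Q + 1): the trace of the Gram matrix is its
    nonzero eigenvalue times the dimension.\<close>
  have factor: "(Q ^ 3 + 1) * (Q + 1) = ((Q + 1)\<^sup>2 / Q) * (Q ^ 3 - Q\<^sup>2 + Q)"
    using Q by (simp add: field_simps eval_nat_numeral)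
  have Qpos: "0 < Q" using Q by linarith
  \<comment> \<open>The aim is to bound the eigenvalue by the dimension d. By \<open>factor\<close>
    there are then at most d^2 points, so that \<open>(real ^ 'n) ^ 'n\<close> can be the auxiliary
    space in \<open>gram_realization\<close>.\<close>
  have "2 * Q \<le> Q * Q" using Q by (intro mult_right_mono) auto
  moreover have "1 \<le> 2 * Q" using Q by linarith
  moreover have "(Q + 1)\<^sup>2 = Q * Q + 2 * Q + 1" "3 * Q\<^sup>2 = Q * Q + Q * Q + Q * Q"
    by (simp_all add: power2_eq_square algebra_simps)
  ultimately have "(Q + 1)\<^sup>2 \<le> 3 * Q\<^sup>2" by linarith
  also have "2 * 1 \<le> Q * (Q - 1)" using Q by (intro mult_mono) auto
  then have "3 * Q\<^sup>2 \<le> (Q * (Q - 1) + 1) * Q\<^sup>2" by (intro mult_right_mono) auto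
  also have "\<dots> = Q * (Q ^ 3 - Q\<^sup>2 + Q)" by (simp add: algebra_simps eval_nat_numeral)
  finally have "(Q + 1)\<^sup>2 / Q \<le> Q ^ 3 - Q\<^sup>2 + Q"
    unfolding pos_divide_le_eq[OF Qpos] by (simp only: mult.commute)
  moreover have "0 \<le> Q ^ 3 - Q\<^sup>2 + Q" unfolding dimQ[symmetric] by simp
  ultimately have "(Q ^ 3 + 1) * (Q + 1) \<le> (Q ^ 3 - Q\<^sup>2 + Q) * (Q ^ 3 - Q\<^sup>2 + Q)"
    unfolding factor by (rule mult_right_mono)
  moreover have card: "real (card points) = (Q ^ 3 + 1) * (Q + 1)"
    by (simp add: card_points Q_def algebra_simps)
  ultimately have "real (card points) \<le> real (CARD('n) * CARD('n))"
    unfolding of_nat_mult dimQ by simp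
  then have small: "card points \<le> DIM((real ^ 'n) ^ 'n)" unfolding of_nat_le_iff by simp
  have "(\<Sum>x\<in>points. gram x x) = real (card points)" by (simp add: gram_def)
  also have "\<dots> = ((Q + 1)\<^sup>2 / Q) * real CARD('n)" unfolding card factor dimQ ..
  finally have trace: "(\<Sum>x\<in>points. gram x x) = ((real q + 1)\<^sup>2 / q) * DIM(real ^ 'n)"
    by (simp add: Q_def)
  have pos: "(real q + 1)\<^sup>2 / q > 0" using q_ge_2 by simp
  have "\<exists>f :: _ \<Rightarrow> real ^ 'n. \<forall>x\<in>points. \<forall>y\<in>points. inner (f x) (f y) = gram x y"
  proof (rule gram_realization[OF finite_points small gram_sym gram_square pos trace])
    fix f :: "_ \<Rightarrow> real ^ 'n"
    assume "\<And>x y. x \<in> points \<Longrightarrow> y \<in> points \<Longrightarrow> inner (f x) (f y) = gram x y"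
    then show ?thesis by blast
  qed
  then obtain f :: "_ \<Rightarrow> real ^ 'n" where
    f: "\<And>x y. x \<in> points \<Longrightarrow> y \<in> points \<Longrightarrow> inner (f x) (f y) = gram x y"
    by blast
  \<comment> \<open>Unit vectors with inner product 1 / Q^2 have squared distance 2 - 2 / Q^2; the
    radius is half that distance.\<close>
  define r where "r = sqrt (2 - 2 / Q\<^sup>2) / 2"
  have "1 < Q\<^sup>2" using Q by (intro one_less_power) auto
  then have inv: "1 / Q\<^sup>2 < 1" "0 < 1 / Q\<^sup>2" "- 1 / Q < 0" using Qpos by simp_all
  moreover have "2 / Q\<^sup>2 = 2 * (1 / Q\<^sup>2)" by simp
  ultimately have "2 - 2 / Q\<^sup>2 > 0" by linarith
  then have r: "r > 0" "2 * r = sqrt (2 - 2 / Q\<^sup>2)" by (simp_all add: r_def)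
  have dist: "dist (f x) (f y) = sqrt (2 - 2 * gram x y)" if "x \<in> points" "y \<in> points" for x y
  proof -
    have "(dist (f x) (f y))\<^sup>2 = 2 - 2 * gram x y"
      using that f by (simp add: dist_norm power2_norm_eq_inner inner_diff_left inner_diff_right inner_commute gram_sym[of y x] gram_def)
    then show ?thesis by (metis real_sqrt_unique zero_le_dist)
  qed
  have gram_Q: "gram x y = (if x = y then 1 else if collinear x y then - 1 / Q else 1 / Q\<^sup>2)" for x y
    by (simp add: gram_def Q_def)
  \<comment> \<open>The largest off-diagonal entry is 1 / Q^2, attained exactly at noncollinear
    pairs: these are the closest centres.\<close>
  have "1 \<noteq> 1 / Q\<^sup>2" "- 1 / Q \<noteq> 1 / Q\<^sup>2" "- 1 / Q \<le> 1 / Q\<^sup>2" using inv by linarith+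
  then have gram_cases: "gram x y = 1 / Q\<^sup>2 \<longleftrightarrow> noncollinear x y" "x \<noteq> y \<Longrightarrow> gram x y \<le> 1 / Q\<^sup>2" for x y
    unfolding gram_Q by (metis order_refl)+
  have noncol: "dist (f x) (f y) = 2 * r \<longleftrightarrow> noncollinear x y" if "x \<in> points" "y \<in> points" for x y
    unfolding dist[OF that] r(2) real_sqrt_eq_iff gram_cases(1)[symmetric] by linarith
  have far: "dist (f x) (f y) \<ge> 2 * r" if "x \<in> points" "y \<in> points" "x \<noteq> y" for x y
    unfolding dist[OF that(1,2)] r(2) real_sqrt_le_iff using gram_cases(2)[OF that(3)] by linarith
  define g where "g x = cball (f x) r" for x
  have adj: "tangent (g x) (g y) \<longleftrightarrow> noncollinear x y" if "x \<in> points" "y \<in> points" for x y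
    unfolding g_def tangent_cball_iff[OF r(1)] by (rule noncol[OF that])
  have inj: "inj_on g points"
  proof (rule inj_onI)
    fix x y assume xy: "x \<in> points" "y \<in> points" "g x = g y"
    then have "f x = f y" using r(1) by (simp add: g_def cball_eq_cball_iff)
    then have "\<not> dist (f x) (f y) \<ge> 2 * r" using r(1) by simp
    with far[OF xy(1,2)] show "x = y" by blast
  qed
  have "unit_ball_packing (g ` points)"
    unfolding g_def using r(1) far by (rule unit_ball_packing_image)
  moreover have "\<exists>v k l m. strongly_regular (g ` points) tangent v k l m"
    using strongly_regular_image[OF inj adj strongly_regular_complement[OF strongly_regular_collinear]] by blast
  moreover have "chromatic_number (g ` points) tangent = q ^ 3 + 1"
  proof -
    have "colorable (g ` points) tangent = colorable points noncollinear"
      using colorable_image[where adj' = tangent and adj = noncollinear, OF inj adj] by (rule ext)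
    then show ?thesis using chromatic_number_noncollinear unfolding chromatic_number_def by (simp only:)
  qed
  ultimately show ?thesis by blast
qed

end

section \<open>A field of the characteristic determined by the dimension\<close>

text \<open>The characteristic must be read off the type \<open>'n\<close>, as types cannot depend on the
  variable \<open>q\<close>; the dimension \<open>q\<^sup>3 - q\<^sup>2 + q\<close> determines \<open>q\<close>.\<close>

definition dim_prime :: "'n itself \<Rightarrow> nat" where
  "dim_prime t = (if \<exists>q. primepow q \<and> CARD('n) = q ^ 3 - q ^ 2 + q
     then aprimedivisor (SOME q. primepow q \<and> CARD('n) = q ^ 3 - q ^ 2 + q) else 2)"

text \<open>The default 2 keeps the value prime for every \<open>'n\<close>, as the type class
  instance below requires.\<close>

lemma prime_dim_prime: "prime (dim_prime TYPE('n))"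
proof (cases "\<exists>q. primepow q \<and> CARD('n) = q ^ 3 - q ^ 2 + q")
  case True
  then have "primepow (SOME q. primepow q \<and> CARD('n) = q ^ 3 - q ^ 2 + q)"
    using someI_ex[OF True] by blast
  then obtain p k where "prime p" "k > 0" "(SOME q. primepow q \<and> CARD('n) = q ^ 3 - q ^ 2 + q) = p ^ k"
    by (auto simp: primepow_def)
  moreover from this have "dim_prime TYPE('n) = p"
    unfolding dim_prime_def using True by (simp only: if_True aprimedivisor_prime_power)
  ultimately show ?thesis by simp
next
  case False
  then show ?thesis unfolding dim_prime_def by (simp only: if_False two_is_prime_nat)
qed

text \<open>An index type of prime size p, so that \<open>mod_ring\<close> over it is the prime
  field of characteristic p.\<close>

typedef 'n prime_index = "{..<dim_prime TYPE('n)}"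
  using prime_gt_0_nat[OF prime_dim_prime] by auto

lemma CARD_prime_index: "CARD('n prime_index) = dim_prime TYPE('n)"
  using type_definition.card[OF type_definition_prime_index] by simp

instance prime_index :: (type) prime_card
  by standard (simp add: CARD_prime_index prime_dim_prime)

text \<open>Passing from q to q + 1 increases the dimension by 3 q^2 + q + 1. Hence the dimension
  determines q.\<close>

lemma dimension_strict_mono:
  fixes q q' :: nat
  assumes "q < q'"
  shows "q ^ 3 - q ^ 2 + q < q' ^ 3 - q' ^ 2 + q'"
proof -
  have "strict_mono (\<lambda>q::nat. q ^ 3 - q ^ 2 + q)"
  proof (rule strict_monoI_Suc)
    fix q :: nat
    have "q ^ 2 \<le> q ^ 3" by (cases "q = 0") (auto intro: power_increasing)
    moreover have "Suc q ^ 3 = q ^ 3 + 3 * q ^ 2 + 3 * q + 1" "Suc q ^ 2 = q ^ 2 + 2 * q + 1"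
      by (simp_all add: eval_nat_numeral algebra_simps)
    ultimately show "q ^ 3 - q ^ 2 + q < Suc q ^ 3 - Suc q ^ 2 + Suc q" by linarith
  qed
  then show ?thesis using assms by (simp add: strict_mono_def)
qed

lemma dim_prime_eq:
  assumes q: "primepow q" and card: "CARD('n) = q ^ 3 - q ^ 2 + q"
  shows "dim_prime TYPE('n) = aprimedivisor q"
proof -
  have "q' = q" if "CARD('n) = q' ^ 3 - q' ^ 2 + q'" for q'
    using dimension_strict_mono[of q q'] dimension_strict_mono[of q' q] that card
    by (metis linorder_neqE_nat order_less_irrefl)
  then have "(SOME q. primepow q \<and> CARD('n) = q ^ 3 - q ^ 2 + q) = q"
    using q card by (intro some_equality) auto
  with q card show ?thesis unfolding dim_prime_def by metis
qed

theorem mainTheorem1: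
  fixes q :: nat
  assumes "primepow q"
    and "CARD('n::finite) = q ^ 3 - q ^ 2 + q"
  shows "\<exists>P :: (real ^ 'n) set set.
           unit_ball_packing P \<and>
           (\<exists>v k l m. strongly_regular P tangent v k l m) \<and>
           chromatic_number P tangent = q ^ 3 + 1"
proof -
  obtain p n where pn: "prime p" "n > 0" "q = p ^ n" using assms(1) by (auto simp: primepow_def)
  have "dim_prime TYPE('n) = p"
    using dim_prime_eq[OF assms] pn by (simp add: aprimedivisor_prime_power)
  then have "CHAR('n prime_index mod_ring alg_closure) = p"
    by (simp add: CARD_prime_index)
  \<comment> \<open>The algebraic closure of the prime field with p elements is the ambient
    field.\<close>
  then interpret frobenius q n "TYPE('n prime_index mod_ring alg_closure)"
    using pn by unfold_locales auto
  show ?thesis by (rule packing_exists[OF assms(2)])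
qed

end
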